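(* For every $n\in\mathbb{N}$ (with $n\ge 1$), the domination polynomial of the generalized book graph $B_{n,5}$ is \[ D(B_{n,5},x)=x^2(x+1)^{2n+1}-2x^{n+1}+(x^2+2x)^n(2x^2+3x). \]
   Context: All graphs are finite and simple. For a graph $G=(V,E)$, a set $S\subseteq V$ is dominating if every vertex of $V\setminus S$ is adjacent to a vertex of $S$. Let $d(G,i)$ be the number of dominating sets of $G$ of size $i$; the domination polynomial is $D(G,x)=\sum_{i=\gamma(G)}^{|V|} d(G,i)x^i$, where $\gamma(G)$ is the minimum size of a dominating set. The generalized book graph $B_{n,5}$ has vertex set $\{u_1,u_2,u_3\}\cup\{v_i,w_i:1\le i\le n\}$ and edge set $\{u_1u_2,u_2u_3\}\cup\{u_3w_i:1\le i\le n\}\cup\{u_1v_i:1\le i\le n\}\cup\{v_iw_i:1\le i\le n\}$; that is, $n$ copies of the $5$-cycle $C_5$ sharing the common path $u_1u_2u_3$. *)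

theory Defs
  imports "Graph_Theory.Pair_Digraph" "HOL-Computational_Algebra.Polynomial"
begin

text \<open>
  A finite simple graph is a \<^locale>\<open>pair_graph\<close>, i.e. a finite, loop-free digraph with a
  symmetric arc relation: an edge \<open>uv\<close> is represented by the two arcs \<open>(u, v)\<close> and \<open>(v, u)\<close>.
\<close>

definition dominating_set :: "'a pair_pre_digraph \<Rightarrow> 'a set \<Rightarrow> bool" where
  "dominating_set G S \<longleftrightarrow>
     S \<subseteq> pverts G \<and> (\<forall>v \<in> pverts G - S. \<exists>u \<in> S. (v, u) \<in> parcs G)"

definition num_dominating_sets :: "'a pair_pre_digraph \<Rightarrow> nat \<Rightarrow> nat" where
  "num_dominating_sets G i = card {S. dominating_set G S \<and> card S = i}"

definition domination_number :: "'a pair_pre_digraph \<Rightarrow> nat" where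
  "domination_number G = Min {card S | S. dominating_set G S}"

definition domination_poly :: "'a pair_pre_digraph \<Rightarrow> int poly" where
  "domination_poly G =
     (\<Sum>i = domination_number G..card (pverts G). monom (int (num_dominating_sets G i)) i)"

datatype book_vertex = U1 | U2 | U3 | V nat | W nat

definition book5_edges :: "nat \<Rightarrow> (book_vertex \<times> book_vertex) set" where
  "book5_edges n =
     {(U1, U2), (U2, U3)} \<union> {(U3, W i) | i. i \<in> {1..n}} \<union> {(U1, V i) | i. i \<in> {1..n}}
       \<union> {(V i, W i) | i. i \<in> {1..n}}"

definition book5 :: "nat \<Rightarrow> book_vertex pair_pre_digraph" where
  "book5 n =
     \<lparr> pverts = {U1, U2, U3} \<union> V ` {1..n} \<union> W ` {1..n},
       parcs = book5_edges n \<union> (book5_edges n)\<inverse> \<rparr>"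

lemma pair_graph_book5: "pair_graph (book5 n)"
proof -
  have arc: "a \<in> pverts (book5 n) \<and> b \<in> pverts (book5 n) \<and> a \<noteq> b"
    if "(a, b) \<in> book5_edges n" for a b
    using that unfolding book5_edges_def book5_def by fastforce
  have arc': "fst e \<in> pverts (book5 n)" "snd e \<in> pverts (book5 n)" "fst e \<noteq> snd e"
    if "e \<in> parcs (book5 n)" for e
  proof -
    have "(fst e, snd e) \<in> book5_edges n \<or> (snd e, fst e) \<in> book5_edges n"
      using that by (cases e) (simp add: book5_def)
    then show "fst e \<in> pverts (book5 n)" "snd e \<in> pverts (book5 n)" "fst e \<noteq> snd e"
      by (metis arc)+
  qed
  have fin: "finite (pverts (book5 n))"
    by (simp add: book5_def)
  have "parcs (book5 n) \<subseteq> pverts (book5 n) \<times> pverts (book5 n)"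
    by (rule subsetI) (simp only: mem_Times_iff arc' simp_thms)
  then have fin': "finite (parcs (book5 n))"
    using fin by (meson finite_SigmaI finite_subset)
  have wf: "pair_wf_digraph (book5 n)"
    by (rule pair_wf_digraph.intro) (rule arc', assumption)+
  have sym: "symmetric (with_proj (book5 n))"
    by (simp add: symmetric_def book5_def sym_Un_converse)
  show ?thesis
    by (intro pair_graph.intro pair_digraph.intro pair_pseudo_graph.intro pair_fin_digraph.intro
        pair_sym_digraph.intro pair_loopfree_digraph.intro pair_fin_digraph_axioms.intro
        pair_sym_digraph_axioms.intro pair_loopfree_digraph_axioms.intro wf fin fin' sym arc')
qed

end

theory Submission
  imports Defs
begin

text \<open>
  Split a dominating set \<open>S\<close> of the book into its trace on the spine \<open>{u\<^sub>1, u\<^sub>2, u\<^sub>3}\<close> and its trace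
  \<open>R\<close> on the pages \<open>{v\<^sub>i, w\<^sub>i}\<close>. If \<open>S\<close> contains \<open>u\<^sub>1\<close> and \<open>u\<^sub>3\<close>, then \<open>R\<close> is arbitrary. Otherwise
  \<open>R\<close> has to meet every page, each page contributing a factor \<open>x\<^sup>2 + 2x\<close>, and this suffices if
  \<open>u\<^sub>2 \<in> S\<close>. If \<open>S\<close> meets the spine in \<open>u\<^sub>1\<close> only, then \<open>u\<^sub>3\<close> needs some \<open>w\<^sub>i \<in> R\<close>, which excludes
  the single set \<open>R = {v\<^sub>1, \<dots>, v\<^sub>n}\<close>; the case of \<open>u\<^sub>3\<close> is symmetric. Finally, \<open>S\<close> must meet the
  spine because of \<open>u\<^sub>2\<close>.
\<close>

text \<open>Taking \<open>x\<close> from an arbitrary commutative ring keeps the counting free of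
  coefficients; polynomials enter only through the choice \<open>x = [:0, 1:]\<close>.\<close>

definition size_gf :: "'b::comm_ring_1 \<Rightarrow> 'a set set \<Rightarrow> 'b" where
  "size_gf x F = (\<Sum>S\<in>F. x ^ card S)"

lemma size_gf_empty [simp]: "size_gf x {} = 0"
  by (simp add: size_gf_def)

lemma size_gf_remove:
  assumes "finite F" "S \<in> F"
  shows "size_gf x (F - {S}) = size_gf x F - x ^ card S"
  using assms by (simp add: size_gf_def sum_diff1)

text \<open>Each subset of the disjoint union splits uniquely into its traces \<open>T\<close> and
  \<open>R\<close>, and their sizes add. As \<open>P\<close> is arbitrary, the condition left for
  \<open>R\<close> may depend on \<open>T\<close>; this serves both to peel off a single page and to
  separate the spine from the pages.\<close>

lemma size_gf_Un:
  assumes "finite A" "finite B" "A \<inter> B = {}"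
  shows "size_gf x {S \<in> Pow (A \<union> B). P S} =
    (\<Sum>T\<in>Pow A. x ^ card T * size_gf x {R \<in> Pow B. P (T \<union> R)})"
proof -
  have "(\<Sum>T\<in>Pow A. x ^ card T * size_gf x {R \<in> Pow B. P (T \<union> R)}) =
      (\<Sum>T\<in>Pow A. \<Sum>R\<in>{R \<in> Pow B. P (T \<union> R)}. x ^ card (T \<union> R))"
  proof (intro sum.cong refl)
    fix T assume T: "T \<in> Pow A"
    have "x ^ card T * x ^ card R = x ^ card (T \<union> R)" if "R \<in> Pow B" for R
    proof -
      have "card (T \<union> R) = card T + card R"
        using T that assms by (intro card_Un_disjoint) (auto intro: finite_subset)
      then show ?thesis by (simp add: power_add)
    qed
    then show "x ^ card T * size_gf x {R \<in> Pow B. P (T \<union> R)} =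
        (\<Sum>R\<in>{R \<in> Pow B. P (T \<union> R)}. x ^ card (T \<union> R))"
      unfolding size_gf_def sum_distrib_left by (intro sum.cong) auto
  qed
  also have "\<dots> = (\<Sum>(T, R)\<in>(SIGMA T:Pow A. {R \<in> Pow B. P (T \<union> R)}). x ^ card (T \<union> R))"
    using assms by (intro sum.Sigma) auto
  also have "\<dots> = size_gf x {S \<in> Pow (A \<union> B). P S}"
    unfolding size_gf_def
  proof (rule sum.reindex_bij_witness[where i = "\<lambda>S. (S \<inter> A, S \<inter> B)" and j = "\<lambda>(T, R). T \<union> R"],
      goal_cases)
    case (1 a)
    then show ?case using assms(3) by (auto; blast)
  next
    case (2 a)
    then show ?case by auto
  next
    case (3 b)
    then show ?case by auto
  next
    case (4 b)
    then have "b \<inter> A \<union> b \<inter> B = b" by auto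
    then show ?case using 4 by auto
  next
    case (5 a)
    then show ?case by auto
  qed
  finally show ?thesis ..
qed

lemma size_gf_Pow:
  assumes "finite A"
  shows "size_gf x (Pow A) = (x + 1) ^ card A"
  using assms
proof (induction A)
  case empty
  then show ?case by (simp add: size_gf_def)
next
  case (insert a A)
  \<comment> \<open>Leaving \<open>a\<close> out contributes the factor 1, taking it contributes
    \<open>x\<close>.\<close>
  have "size_gf x (Pow (insert a A)) = (\<Sum>T\<in>Pow {a}. x ^ card T * size_gf x (Pow A))"
    using size_gf_Un[of "{a}" A x "\<lambda>_. True"] insert.hyps by (simp add: Pow_def)
  then show ?case
    using insert by (simp add: Pow_insert algebra_simps)
qed

text \<open>Group the dominating sets by size. Starting the sum at the domination number loses none
  of them, since that number is the minimum of the sizes.\<close>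

lemma domination_poly_eq_size_gf:
  assumes "finite (pverts G)"
  shows "domination_poly G = size_gf [:0, 1:] {S. dominating_set G S}"
proof -
  let ?D = "{S. dominating_set G S}"
  let ?I = "{domination_number G..card (pverts G)}"
  have sub: "?D \<subseteq> Pow (pverts G)" by (auto simp: dominating_set_def)
  then have fin: "finite ?D" using assms finite_subset by blast
  have "{card S |S. dominating_set G S} = card ` ?D" by auto
  then have img: "card ` ?D \<subseteq> ?I"
    using fin sub assms by (auto simp: domination_number_def intro!: Min_le card_mono)
  have "size_gf [:0, 1:] ?D = (\<Sum>i\<in>?I. \<Sum>S\<in>{S \<in> ?D. card S = i}. [:0, 1::int:] ^ card S)"
    unfolding size_gf_def by (intro sum.group[symmetric] fin img finite_atLeastAtMost)
  also have "\<dots> = (\<Sum>i\<in>?I. monom (int (num_dominating_sets G i)) i)"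
    by (intro sum.cong refl)
      (simp add: num_dominating_sets_def monom_altdef of_nat_poly)
  finally show ?thesis by (simp add: domination_poly_def)
qed

definition pages :: "nat \<Rightarrow> book_vertex set" where
  "pages n = V ` {1..n} \<union> W ` {1..n}"

definition page_transversals :: "nat \<Rightarrow> book_vertex set set" where
  "page_transversals n = {R \<in> Pow (pages n). \<forall>i\<in>{1..n}. V i \<in> R \<or> W i \<in> R}"

lemma finite_pages [simp]: "finite (pages n)"
  by (simp add: pages_def)

lemma card_pages: "card (pages n) = 2 * n"
  unfolding pages_def by (subst card_Un_disjoint) (auto simp: card_image inj_on_def)

lemma size_gf_page_transversals:
  "size_gf x (page_transversals n) = (x ^ 2 + 2 * x) ^ n"
proof (induction n)
  case 0
  have "page_transversals 0 = {{}}" by (auto simp: page_transversals_def pages_def)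
  then show ?case by (simp add: size_gf_def)
next
  case (Suc n)
  let ?A = "{V (Suc n), W (Suc n)}"
  let ?P = "\<lambda>R. \<forall>i\<in>{1..Suc n}. V i \<in> R \<or> W i \<in> R"
  have pages_Suc: "pages (Suc n) = ?A \<union> pages n"
    by (auto simp: pages_def atLeastAtMostSuc_conv)
  have "size_gf x (page_transversals (Suc n)) =
      (\<Sum>T\<in>Pow ?A. x ^ card T * size_gf x {R \<in> Pow (pages n). ?P (T \<union> R)})"
    unfolding page_transversals_def pages_Suc by (rule size_gf_Un) (auto simp: pages_def)
  \<comment> \<open>Only the emptiness of \<open>T\<close> matters: a nonempty \<open>T\<close>
    already meets the new page, and the requirements on the older pages concern \<open>R\<close>
    alone.\<close>
  also have "\<dots> = (\<Sum>T\<in>Pow ?A. x ^ card T *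
      (if T = {} then 0 else size_gf x (page_transversals n)))"
  proof (intro sum.cong refl)
    fix T assume T: "T \<in> Pow ?A"
    have "?P (T \<union> R) \<longleftrightarrow> T \<noteq> {} \<and> (\<forall>i\<in>{1..n}. V i \<in> R \<or> W i \<in> R)" if "R \<in> Pow (pages n)" for R
    proof -
      have "V (Suc n) \<in> T \<union> R \<or> W (Suc n) \<in> T \<union> R \<longleftrightarrow> T \<noteq> {}"
        using T that by (auto simp: pages_def)
      moreover have "V i \<notin> T \<and> W i \<notin> T" if "i \<in> {1..n}" for i
        using T that by auto
      ultimately show ?thesis
        by (simp add: atLeastAtMostSuc_conv)
    qed
    then have "{R \<in> Pow (pages n). ?P (T \<union> R)} = (if T = {} then {} else page_transversals n)"
      unfolding page_transversals_def by auto
    then show "x ^ card T * size_gf x {R \<in> Pow (pages n). ?P (T \<union> R)} =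
        x ^ card T * (if T = {} then 0 else size_gf x (page_transversals n))"
      by simp
  qed
  \<comment> \<open>The nonempty choices of \<open>T\<close> are two singletons and one
    pair.\<close>
  also have "\<dots> = (x ^ 2 + 2 * x) * size_gf x (page_transversals n)"
    by (simp add: Pow_insert insert_eq_iff doubleton_eq_iff algebra_simps power2_eq_square)
  finally show ?case using Suc by simp
qed

text \<open>There is one condition for each closed neighbourhood that \<open>S\<close> has to meet.
  From here on the graph is replaced by membership conditions.\<close>

lemma dominating_set_book5_iff:
  "dominating_set (book5 n) S \<longleftrightarrow> S \<subseteq> {U1, U2, U3} \<union> pages n \<and>
     (U1 \<in> S \<or> U2 \<in> S \<or> (\<exists>i\<in>{1..n}. V i \<in> S)) \<and>
     (U2 \<in> S \<or> U1 \<in> S \<or> U3 \<in> S) \<and>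
     (U3 \<in> S \<or> U2 \<in> S \<or> (\<exists>i\<in>{1..n}. W i \<in> S)) \<and>
     (\<forall>i\<in>{1..n}. V i \<in> S \<or> U1 \<in> S \<or> W i \<in> S) \<and>
     (\<forall>i\<in>{1..n}. W i \<in> S \<or> U3 \<in> S \<or> V i \<in> S)"
proof -
  have verts: "pverts (book5 n) = {U1, U2, U3} \<union> pages n"
    by (auto simp: book5_def pages_def)
  have arcs:
    "(U1, u) \<in> parcs (book5 n) \<longleftrightarrow> u = U2 \<or> (\<exists>i\<in>{1..n}. u = V i)"
    "(U2, u) \<in> parcs (book5 n) \<longleftrightarrow> u = U1 \<or> u = U3"
    "(U3, u) \<in> parcs (book5 n) \<longleftrightarrow> u = U2 \<or> (\<exists>i\<in>{1..n}. u = W i)"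
    "(V i, u) \<in> parcs (book5 n) \<longleftrightarrow> i \<in> {1..n} \<and> (u = U1 \<or> u = W i)"
    "(W i, u) \<in> parcs (book5 n) \<longleftrightarrow> i \<in> {1..n} \<and> (u = U3 \<or> u = V i)" for u i
    by (auto simp: book5_def book5_edges_def)
  have neighbours:
    "(\<exists>u\<in>S. (U1, u) \<in> parcs (book5 n)) \<longleftrightarrow> U2 \<in> S \<or> (\<exists>i\<in>{1..n}. V i \<in> S)"
    "(\<exists>u\<in>S. (U2, u) \<in> parcs (book5 n)) \<longleftrightarrow> U1 \<in> S \<or> U3 \<in> S"
    "(\<exists>u\<in>S. (U3, u) \<in> parcs (book5 n)) \<longleftrightarrow> U2 \<in> S \<or> (\<exists>i\<in>{1..n}. W i \<in> S)"
    "(\<exists>u\<in>S. (V i, u) \<in> parcs (book5 n)) \<longleftrightarrow> i \<in> {1..n} \<and> (U1 \<in> S \<or> W i \<in> S)"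
    "(\<exists>u\<in>S. (W i, u) \<in> parcs (book5 n)) \<longleftrightarrow> i \<in> {1..n} \<and> (U3 \<in> S \<or> V i \<in> S)" for i
    unfolding arcs by blast+
  have "(\<forall>v\<in>pverts (book5 n) - S. Q v) \<longleftrightarrow>
      (U1 \<in> S \<or> Q U1) \<and> (U2 \<in> S \<or> Q U2) \<and> (U3 \<in> S \<or> Q U3) \<and>
      (\<forall>i\<in>{1..n}. V i \<in> S \<or> Q (V i)) \<and> (\<forall>i\<in>{1..n}. W i \<in> S \<or> Q (W i))" for Q
    unfolding verts pages_def by blast
  then show ?thesis
    unfolding verts[symmetric] by (simp add: dominating_set_def neighbours)
qed

text \<open>A transversal that avoids every \<open>W i\<close> is forced to take \<open>V i\<close>
  from each page, so there is exactly one such set.\<close>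

lemma page_transversals_meeting_W:
  "{R \<in> page_transversals n. \<exists>i\<in>{1..n}. W i \<in> R} = page_transversals n - {V ` {1..n}}"
proof -
  have "R = V ` {1..n}" if "R \<in> page_transversals n" "\<forall>i\<in>{1..n}. W i \<notin> R" for R
    using that by (fastforce simp: page_transversals_def pages_def)
  then show ?thesis by blast
qed

lemma page_transversals_meeting_V:
  "{R \<in> page_transversals n. \<exists>i\<in>{1..n}. V i \<in> R} = page_transversals n - {W ` {1..n}}"
proof -
  have "R = W ` {1..n}" if "R \<in> page_transversals n" "\<forall>i\<in>{1..n}. V i \<notin> R" for R
    using that by (fastforce simp: page_transversals_def pages_def)
  then show ?thesis by blast
qed

text \<open>The parameter \<open>C\<close> lets both symmetric cases share one proof; the removed
  set has one vertex per page, hence weight \<open>x ^ n\<close>.\<close>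

lemma size_gf_page_transversals_remove:
  assumes "C = V \<or> C = W"
  shows "size_gf x (page_transversals n - {C ` {1..n}}) = (x ^ 2 + 2 * x) ^ n - x ^ n"
proof -
  have "card (C ` {1..n}) = n" using assms by (auto simp: card_image inj_on_def)
  moreover have "C ` {1..n} \<in> page_transversals n"
    using assms by (auto simp: page_transversals_def pages_def)
  moreover have "finite (page_transversals n)"
    by (simp add: page_transversals_def)
  ultimately show ?thesis
    by (simp add: size_gf_remove size_gf_page_transversals)
qed

theorem theorem3p4:
  fixes n :: nat
  assumes "n \<ge> 1"
  shows "domination_poly (book5 n) =
    (let x = [:0, 1:] in
      x ^ 2 * (x + 1) ^ (2 * n + 1) - 2 * x ^ (n + 1) + (x ^ 2 + 2 * x) ^ n * (2 * x ^ 2 + 3 * x))"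
proof -
  define x :: "int poly" where "x = [:0, 1:]"
  let ?D = "dominating_set (book5 n)"
  let ?F = "\<lambda>T. {R \<in> Pow (pages n). ?D (T \<union> R)}"
  \<comment> \<open>The conditions for \<open>V i\<close> and \<open>W i\<close> differ only in the
    spine vertex that can replace meeting the page, so they merge: either both \<open>U1\<close> and
    \<open>U3\<close> lie in \<open>T\<close>, or \<open>R\<close> meets every page.\<close>
  have F: "?F T = {R \<in> Pow (pages n).
      (U1 \<in> T \<or> U2 \<in> T \<or> (\<exists>i\<in>{1..n}. V i \<in> R)) \<and> (U2 \<in> T \<or> U1 \<in> T \<or> U3 \<in> T) \<and>
      (U3 \<in> T \<or> U2 \<in> T \<or> (\<exists>i\<in>{1..n}. W i \<in> R)) \<and>
      (U1 \<in> T \<and> U3 \<in> T \<or> (\<forall>i\<in>{1..n}. V i \<in> R \<or> W i \<in> R))}"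
    if T: "T \<subseteq> {U1, U2, U3}" for T
  proof (intro Collect_cong conj_cong refl)
    fix R assume R: "R \<in> Pow (pages n)"
    have "U1 \<notin> R" "U2 \<notin> R" "U3 \<notin> R" "V i \<notin> T" "W i \<notin> T" for i
      using T R by (auto simp: pages_def)
    moreover have "T \<union> R \<subseteq> {U1, U2, U3} \<union> pages n"
      using T R by blast
    ultimately show "?D (T \<union> R) \<longleftrightarrow>
        (U1 \<in> T \<or> U2 \<in> T \<or> (\<exists>i\<in>{1..n}. V i \<in> R)) \<and> (U2 \<in> T \<or> U1 \<in> T \<or> U3 \<in> T) \<and>
        (U3 \<in> T \<or> U2 \<in> T \<or> (\<exists>i\<in>{1..n}. W i \<in> R)) \<and>
        (U1 \<in> T \<and> U3 \<in> T \<or> (\<forall>i\<in>{1..n}. V i \<in> R \<or> W i \<in> R))"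
      unfolding dominating_set_book5_iff Un_iff by (simp only: simp_thms) blast
  qed
  have full: "?F {U1, U3} = Pow (pages n)" "?F {U1, U2, U3} = Pow (pages n)"
    by (subst F; simp add: Pow_def)+
  have transversal: "?F {U2} = page_transversals n" "?F {U1, U2} = page_transversals n"
      "?F {U2, U3} = page_transversals n"
    by (subst F; simp add: page_transversals_def)+
  have "?F {U1} = {R \<in> page_transversals n. \<exists>i\<in>{1..n}. W i \<in> R}"
    by (subst F) (auto simp: page_transversals_def)
  note U1 = this[unfolded page_transversals_meeting_W]
  have "?F {U3} = {R \<in> page_transversals n. \<exists>i\<in>{1..n}. V i \<in> R}"
    by (subst F) (auto simp: page_transversals_def)
  note U3 = this[unfolded page_transversals_meeting_V]
  have none: "?F {} = {}"
    by (subst F) auto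
  have "finite (pverts (book5 n))" by (simp add: book5_def)
  then have "domination_poly (book5 n) = size_gf x {S. ?D S}"
    unfolding x_def by (rule domination_poly_eq_size_gf)
  also have "{S. ?D S} = {S \<in> Pow ({U1, U2, U3} \<union> pages n). ?D S}"
    by (auto simp: dominating_set_book5_iff)
  also have "size_gf x \<dots> = (\<Sum>T\<in>Pow {U1, U2, U3}. x ^ card T * size_gf x (?F T))"
    by (rule size_gf_Un) (auto simp: pages_def)
  also have "Pow {U1, U2, U3} =
      {{}, {U1}, {U2}, {U3}, {U1, U2}, {U1, U3}, {U2, U3}, {U1, U2, U3}}"
    by (auto simp: Pow_insert)
  also have "(\<Sum>T\<in>\<dots>. x ^ card T * size_gf x (?F T)) =
      size_gf x (?F {}) + x * size_gf x (?F {U1}) + x * size_gf x (?F {U2}) + x * size_gf x (?F {U3})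
      + x ^ 2 * size_gf x (?F {U1, U2}) + x ^ 2 * size_gf x (?F {U1, U3})
      + x ^ 2 * size_gf x (?F {U2, U3}) + x ^ 3 * size_gf x (?F {U1, U2, U3})"
    by (subst sum.insert, simp, blast)+ (simp add: numeral_eq_Suc add.assoc)
  also have "\<dots> = x * ((x ^ 2 + 2 * x) ^ n - x ^ n) + x * (x ^ 2 + 2 * x) ^ n
      + x * ((x ^ 2 + 2 * x) ^ n - x ^ n) + x ^ 2 * (x ^ 2 + 2 * x) ^ n
      + x ^ 2 * (x + 1) ^ (2 * n) + x ^ 2 * (x ^ 2 + 2 * x) ^ n + x ^ 3 * (x + 1) ^ (2 * n)"
    unfolding full transversal U1 U3 none size_gf_page_transversals
      size_gf_page_transversals_remove[OF disjI1[OF refl]]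
      size_gf_page_transversals_remove[OF disjI2[OF refl]]
    by (simp add: size_gf_Pow card_pages)
  \<comment> \<open>The two unrestricted cases combine by
    \<open>x ^ 2 + x ^ 3 = x ^ 2 * (x + 1)\<close>, which raises the exponent to
    \<open>2 * n + 1\<close>. The other five nonempty spine traces give
    \<open>3 * x + 2 * x ^ 2\<close>, and the two exceptions give
    \<open>2 * x ^ (n + 1)\<close>.\<close>
  also have "\<dots> = x ^ 2 * (x + 1) ^ (2 * n + 1) - 2 * x ^ (n + 1)
      + (x ^ 2 + 2 * x) ^ n * (2 * x ^ 2 + 3 * x)"
    unfolding power_add power_one_right by algebra
  finally show ?thesis by (simp add: x_def Let_def)
qed

end
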